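(* For $f\in C[0,1]$ let $\tilde f:\mathbb R\to\mathbb R$ be the integral extension of $f$. The formula $$C_{\rm mp}(t)f(x):=\tfrac12\big(\tilde f(x+t)+\tilde f(x-t)\big),\qquad x\in[0,1],\ t\in\mathbb R,\ f\in C[0,1],$$ defines a strongly continuous cosine family $(C_{\rm mp}(t))_{t\in\mathbb R}$ on $C[0,1]$. This family preserves both functionals $F_0$ and $F_1$, i.e. $F_iC_{\rm mp}(t)f=F_if$ for all $f\in C[0,1]$, $t\in\mathbb R$ and $i=0,1$. The generator $A$ of $(C_{\rm mp}(t))_{t\in\mathbb R}$ is given by $$D(A)=\{f\in C^2[0,1]: f'(0)=f'(1)=f(1)-f(0)\},\qquad Af=f''.$$
   Context: $C[0,1]$ is the Banach space of continuous real-valued functions on $[0,1]$ with the supremum norm; $\mathbb N=\{0,1,2,\dots\}$. The moment functionals are $F_if=\int_0^1x^if(x)\,dx$. Integral extension: given $f\in C[0,1]$, define $g_n,h_n\in C[0,1]$, $n\in\mathbb N$, recursively by $g_0(x)=f(x)$, $h_0(x)=f(1-x)$, and $$h_{n+1}=g_n-\psi_n,\qquad g_{n+1}=h_n+\psi_n,$$ where $d_n=h_n-g_n$ and $\psi_n(x)=-e^{2x}\int_0^1d_n(y)\,dy+2\int_0^xe^{2(x-y)}d_n(y)\,dy$, $x\in[0,1]$. The integral extension $\tilde f:\mathbb R\to\mathbb R$ of $f$ is the (well-defined, continuous) function determined by $\tilde f(x+n)=g_n(x)$ and $\tilde f(1-x-n)=h_n(x)$ for $x\in[0,1]$, $n\in\mathbb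 N$. A strongly continuous cosine family on a Banach space $X$ is a family $(\mathrm{Cos}(t))_{t\in\mathbb R}$ of bounded linear operators on $X$ with $\mathrm{Cos}(0)=\mathrm{Id}$, $2\,\mathrm{Cos}(t)\mathrm{Cos}(s)=\mathrm{Cos}(t+s)+\mathrm{Cos}(t-s)$ for all $s,t\in\mathbb R$, and $\lim_{t\to0}\mathrm{Cos}(t)x=x$ for all $x\in X$. Its generator is $x\mapsto\lim_{t\to0}\frac{2}{t^2}(\mathrm{Cos}(t)x-x)$, with domain the set of all $x\in X$ for which this limit exists. *)

theory Defs
  imports "HOL-Analysis.Analysis"
begin

text \<open>
  The space \<open>C[0,1]\<close> is the library's Banach space of bounded continuous functions (with the
  supremum norm) on the metric space \<open>[0,1]\<close>; on this compact space boundedness is automatic.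
\<close>

typedef unit_interval = "{0..1::real}"
  morphisms real_of_ui ui_of_real
  by (rule exI[of _ 0]) simp

instantiation unit_interval :: metric_space
begin

definition dist_unit_interval :: "unit_interval \<Rightarrow> unit_interval \<Rightarrow> real"
  where "dist_unit_interval u v = dist (real_of_ui u) (real_of_ui v)"

definition uniformity_unit_interval :: "(unit_interval \<times> unit_interval) filter"
  where "uniformity_unit_interval = (INF e\<in>{0 <..}. principal {(x, y). dist x y < e})"

definition open_unit_interval :: "unit_interval set \<Rightarrow> bool"
  where "open_unit_interval S = (\<forall>x\<in>S. \<forall>\<^sub>F (x', y) in uniformity. x' = x \<longrightarrow> y \<in> S)"

instance
proof
  fix x y z :: unit_interval
  show "dist x y = 0 \<longleftrightarrow> x = y"
    by (simp add: dist_unit_interval_def real_of_ui_inject)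
  show "dist x y \<le> dist x z + dist y z"
    by (simp add: dist_unit_interval_def dist_triangle2)
qed (simp_all add: uniformity_unit_interval_def open_unit_interval_def)

end

instance bcontfun :: (metric_space, banach) banach ..

type_synonym C01 = "unit_interval \<Rightarrow>\<^sub>C real"

text \<open>
  \<open>fn f\<close> reads \<open>f \<in> C[0,1]\<close> as a function of a real variable, meaningful on \<open>{0..1}\<close> only;
  \<open>of_fn\<close> goes back and is meaningful for functions that are continuous on \<open>{0..1}\<close>.
\<close>

definition fn :: "C01 \<Rightarrow> real \<Rightarrow> real"
  where "fn f x = apply_bcontfun f (ui_of_real x)"

definition of_fn :: "(real \<Rightarrow> real) \<Rightarrow> C01"
  where "of_fn \<phi> = Bcontfun (\<lambda>u. \<phi> (real_of_ui u))"

lemma real_of_ui_in: "real_of_ui u \<in> {0..1}"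
  by (rule real_of_ui)

lemma continuous_on_fn: "continuous_on {0..1} (fn f)"
proof -
  have "continuous_on {0..1} ui_of_real"
    unfolding continuous_on_iff dist_unit_interval_def
    by (auto simp: ui_of_real_inverse)
  then have "continuous_on {0..1} (\<lambda>x. apply_bcontfun f (ui_of_real x))"
    by (rule continuous_on_compose2[OF continuous_on_apply_bcontfun[of UNIV f]]) auto
  then show ?thesis
    by (simp add: fn_def[abs_def])
qed

lemma fn_of_fn:
  assumes "continuous_on {0..1} \<phi>" and x: "x \<in> {0..1}"
  shows "fn (of_fn \<phi>) x = \<phi> x"
proof -
  have "continuous_on UNIV real_of_ui"
    unfolding continuous_on_iff dist_unit_interval_def by auto
  then have c: "continuous_on UNIV (\<lambda>u. \<phi> (real_of_ui u))"
    by (rule continuous_on_compose2[OF assms(1)]) (use real_of_ui in auto)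
  have "bounded (\<phi> ` {0..1})"
    by (intro compact_imp_bounded compact_continuous_image assms) auto
  then have "bounded (range (\<lambda>u. \<phi> (real_of_ui u)))"
    by (rule bounded_subset) (use real_of_ui in auto)
  with c have "(\<lambda>u. \<phi> (real_of_ui u)) \<in> bcontfun"
    by (simp add: bcontfun_def)
  then show ?thesis
    using x by (simp add: fn_def of_fn_def Bcontfun_inverse ui_of_real_inverse)
qed

lemma fn_add [simp]: "fn (f + g) x = fn f x + fn g x"
  by (simp add: fn_def)

lemma fn_diff [simp]: "fn (f - g) x = fn f x - fn g x"
  by (simp add: fn_def)

lemma fn_eqI: "(\<And>x. x \<in> {0..1} \<Longrightarrow> fn f x = fn g x) \<Longrightarrow> f = g"
  by (rule bcontfun_eqI) (metis fn_def real_of_ui real_of_ui_inverse)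

definition moment :: "nat \<Rightarrow> C01 \<Rightarrow> real"
  where "moment i f = integral {0..1} (\<lambda>x. x ^ i * fn f x)"


subsection \<open>The integral extension\<close>

definition psi :: "C01 \<Rightarrow> C01"
  where "psi d = of_fn (\<lambda>x. - exp (2 * x) * integral {0..1} (fn d)
           + 2 * integral {0..x} (\<lambda>y. exp (2 * (x - y)) * fn d y))"

primrec ext_gh :: "C01 \<Rightarrow> nat \<Rightarrow> C01 \<times> C01"
  where
    "ext_gh f 0 = (f, of_fn (\<lambda>x. fn f (1 - x)))"
  | "ext_gh f (Suc n) =
       (let (g, h) = ext_gh f n in (h + psi (h - g), g - psi (h - g)))"

definition ext_g :: "C01 \<Rightarrow> nat \<Rightarrow> C01"
  where "ext_g f n = fst (ext_gh f n)"

definition ext_h :: "C01 \<Rightarrow> nat \<Rightarrow> C01"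
  where "ext_h f n = snd (ext_gh f n)"

definition is_integral_extension :: "C01 \<Rightarrow> (real \<Rightarrow> real) \<Rightarrow> bool"
  where "is_integral_extension f F \<longleftrightarrow>
    (\<forall>n. \<forall>x\<in>{0..1}. F (x + real n) = fn (ext_g f n) x \<and> F (1 - x - real n) = fn (ext_h f n) x)"

definition integral_extension :: "C01 \<Rightarrow> real \<Rightarrow> real"
  where "integral_extension f = (THE F. is_integral_extension f F)"

lemma fn_reflect:
  assumes "x \<in> {0..1}"
  shows "fn (of_fn (\<lambda>x. fn f (1 - x))) x = fn f (1 - x)"
  by (intro fn_of_fn continuous_on_compose2[OF continuous_on_fn] continuous_intros)
     (use assms in auto)

lemma ext_0: "ext_g f 0 = f" "x \<in> {0..1} \<Longrightarrow> fn (ext_h f 0) x = fn f (1 - x)"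
  by (simp_all add: ext_g_def ext_h_def fn_reflect)

lemma ext_Suc:
  "ext_g f (Suc n) = ext_h f n + psi (ext_h f n - ext_g f n)"
  "ext_h f (Suc n) = ext_g f n - psi (ext_h f n - ext_g f n)"
  by (simp_all add: ext_g_def ext_h_def case_prod_beta Let_def)

lemma psi_formula:
  assumes "x \<in> {0..1}"
  shows "fn (psi d) x = exp (2 * x) *
    (2 * integral {0..x} (\<lambda>y. exp (- 2 * y) * fn d y) - integral {0..1} (fn d))"
    and fn_psi: "fn (psi d) x = - exp (2 * x) * integral {0..1} (fn d)
           + 2 * integral {0..x} (\<lambda>y. exp (2 * (x - y)) * fn d y)"
proof -
  let ?I = "\<lambda>x. integral {0..x} (\<lambda>y. exp (- 2 * y) * fn d y)"
  have eq: "integral {0..x} (\<lambda>y. exp (2 * (x - y)) * fn d y) = exp (2 * x) * ?I x" for x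
    by (subst integral_mult_right[symmetric])
       (simp add: exp_add[symmetric] exp_diff exp_minus algebra_simps divide_inverse)
  have "continuous_on {0..1} ?I"
    by (intro indefinite_integral_continuous_1 integrable_continuous_real
        continuous_intros continuous_on_fn)
  then have "continuous_on {0..1} (\<lambda>x. - exp (2 * x) * integral {0..1} (fn d)
      + 2 * (exp (2 * x) * ?I x))"
    by (intro continuous_intros)
  then show "fn (psi d) x = - exp (2 * x) * integral {0..1} (fn d)
           + 2 * integral {0..x} (\<lambda>y. exp (2 * (x - y)) * fn d y)"
    using assms unfolding psi_def eq by (subst fn_of_fn) auto
  then show "fn (psi d) x = exp (2 * x) *
    (2 * integral {0..x} (\<lambda>y. exp (- 2 * y) * fn d y) - integral {0..1} (fn d))"
    unfolding eq by (simp add: algebra_simps)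
qed

lemma integral_psi:
  "integral {0..1} (fn (psi d)) = (fn (psi d) 1 - integral {0..1} (fn d)) / 2"
proof -
  let ?D = "integral {0..1} (fn d)"
  let ?P = "\<lambda>x. exp (2 * x) * (2 * integral {0..x} (\<lambda>y. exp (- 2 * y) * fn d y) - ?D)"
  have deriv: "(fn (psi d) has_real_derivative 2 * fn (psi d) x + 2 * fn d x) (at x within {0..1})"
    if x: "x \<in> {0..1}" for x
  proof -
    have I: "((\<lambda>x. integral {0..x} (\<lambda>y. exp (- 2 * y) * fn d y)) has_real_derivative
        exp (- 2 * x) * fn d x) (at x within {0..1})"
      by (rule integral_has_real_derivative[OF _ x]) (intro continuous_intros continuous_on_fn)
    have "(?P has_real_derivative 2 * ?P x + 2 * fn d x) (at x within {0..1})"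
      by (rule derivative_eq_intros I refl)+
         (simp add: algebra_simps exp_minus)
    then show ?thesis
      by (rule has_field_derivative_transform_within[OF _ zero_less_one x, THEN DERIV_cong])
         (use x in \<open>simp_all add: psi_formula\<close>)
  qed
  have "((\<lambda>x. 2 * fn (psi d) x + 2 * fn d x) has_integral (fn (psi d) 1 - fn (psi d) 0)) {0..1}"
    by (rule fundamental_theorem_of_calculus)
       (use deriv in \<open>auto simp: has_real_derivative_iff_has_vector_derivative\<close>)
  moreover have "((\<lambda>x. 2 * fn (psi d) x + 2 * fn d x) has_integral
      (2 * integral {0..1} (fn (psi d)) + 2 * ?D)) {0..1}"
    by (intro has_integral_add has_integral_mult_right integrable_integral
        integrable_continuous_real continuous_on_fn)
  ultimately have "2 * integral {0..1} (fn (psi d)) + 2 * ?D = fn (psi d) 1 - fn (psi d) 0"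
    by (rule has_integral_unique[symmetric])
  then show ?thesis
    by (simp add: psi_formula[of 0])
qed

lemma integral_fn_diff:
  "integral {0..1} (fn (f - g)) = integral {0..1} (fn f) - integral {0..1} (fn g)"
proof -
  have "fn (f - g) = (\<lambda>x. fn f x - fn g x)" by auto
  then show ?thesis
    by (simp add: integral_diff integrable_continuous_real continuous_on_fn)
qed

lemma integral_fn_add:
  "integral {0..1} (fn (f + g)) = integral {0..1} (fn f) + integral {0..1} (fn g)"
proof -
  have "fn (f + g) = (\<lambda>x. fn f x + fn g x)" by auto
  then show ?thesis
    by (simp add: integral_add integrable_continuous_real continuous_on_fn)
qed

lemma integral_reflect: "integral {0..1} (fn (ext_h f 0)) = integral {0..1} (fn f)"
proof -
  have "((\<lambda>x. fn f x) has_integral integral {0..1} (fn f)) {0..1}"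
    by (simp add: integrable_integral integrable_continuous_real continuous_on_fn)
  then have "((\<lambda>x. fn f (1 - x)) has_integral integral {0..1} (fn f)) {0..1}"
    using has_integral_affinity[of "fn f" "integral {0..1} (fn f)" 0 1 "-1" 1]
    by simp
  then have "integral {0..1} (\<lambda>x. fn f (1 - x)) = integral {0..1} (fn f)"
    by (rule integral_unique)
  moreover have "integral {0..1} (fn (ext_h f 0)) = integral {0..1} (\<lambda>x. fn f (1 - x))"
    by (rule integral_cong) (simp add: ext_0)
  ultimately show ?thesis by simp
qed

lemma ext_matching:
  "fn (ext_g f (Suc n)) 0 = fn (ext_g f n) 1 \<and> fn (ext_h f (Suc n)) 0 = fn (ext_h f n) 1"
proof (induction n)
  case 0
  show ?case
    by (simp add: ext_Suc ext_0 psi_formula integral_fn_diff integral_reflect)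
next
  case (Suc n)
  let ?d = "\<lambda>n. ext_h f n - ext_g f n"
  have "integral {0..1} (fn (?d (Suc n))) = - fn (psi (?d n)) 1"
    by (simp add: ext_Suc[of f n] integral_fn_diff integral_fn_add integral_psi field_simps)
  then have "fn (psi (?d (Suc n))) 0 = fn (psi (?d n)) 1"
    by (simp add: psi_formula[of 0])
  with Suc show ?case
    by (simp add: ext_Suc)
qed

lemma is_integral_extension_ex1: "\<exists>!F. is_integral_extension f F"
proof (rule ex_ex1I)
  define F where "F z = (if 0 \<le> z then fn (ext_g f (nat \<lfloor>z\<rfloor>)) (frac z)
      else fn (ext_h f (nat \<lfloor>1 - z\<rfloor>)) (frac (1 - z)))" for z
  have g: "F (x + real n) = fn (ext_g f n) x" if "x \<in> {0..1}" for x n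
  proof (cases "x = 1")
    case True
    have "\<lfloor>1 + real n\<rfloor> = int (Suc n)" by linarith
    then show ?thesis
      using True ext_matching[of f n] by (simp add: F_def frac_def nat_add_distrib)
  next
    case False
    then have "\<lfloor>x + real n\<rfloor> = int n" using that by (simp add: floor_eq_iff)
    then show ?thesis
      using that by (simp add: F_def frac_def)
  qed
  have h: "F (1 - x - real n) = fn (ext_h f n) x" if "x \<in> {0..1}" for x n
  proof (cases "0 \<le> 1 - x - real n")
    case True
    have "n = 0 \<or> (n = 1 \<and> x = 0)"
    proof (cases n)
      case (Suc m)
      then have "x = 0 \<and> real m = 0"
        using True that by auto
      with Suc show ?thesis by simp
    qed simp
    then consider "n = 0" | "n = 1" "x = 0" by blast
    then show ?thesis
    proof cases
      case 1
      then show ?thesis using g[of "1 - x" 0] that by (simp add: ext_0)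
    next
      case 2
      then show ?thesis using g[of 0 0] ext_matching[of f 0] by (simp add: ext_0)
    qed
  next
    case neg: False
    show ?thesis
    proof (cases "x = 1")
      case True
      have "\<lfloor>1 + real n\<rfloor> = int (Suc n)" by linarith
      then show ?thesis
        using True neg ext_matching[of f n] by (simp add: F_def frac_def nat_add_distrib)
    next
      case False
      then have "\<lfloor>x + real n\<rfloor> = int n" using that by (simp add: floor_eq_iff)
      then show ?thesis
        using that neg by (simp add: F_def frac_def)
    qed
  qed
  show "\<exists>F. is_integral_extension f F"
    using g h unfolding is_integral_extension_def by blast
next
  fix F G
  assume F: "is_integral_extension f F" and G: "is_integral_extension f G"
  show "F = G"
  proof
    fix z :: real
    show "F z = G z"
    proof (cases "0 \<le> z")
      case True
      have "frac z \<in> {0..1}" "z = frac z + real (nat \<lfloor>z\<rfloor>)"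
        using True frac_lt_1[of z] by (auto simp: frac_def)
      then show ?thesis
        using F G unfolding is_integral_extension_def by metis
    next
      case False
      have "frac (1 - z) \<in> {0..1}" "z = 1 - frac (1 - z) - real (nat \<lfloor>1 - z\<rfloor>)"
        using False frac_lt_1[of "1 - z"] by (auto simp: frac_def)
      then show ?thesis
        using F G unfolding is_integral_extension_def by metis
    qed
  qed
qed

lemma integral_extension:
  assumes "x \<in> {0..1}"
  shows "integral_extension f (x + real n) = fn (ext_g f n) x"
    and "integral_extension f (1 - x - real n) = fn (ext_h f n) x"
  using theI'[OF is_integral_extension_ex1, of f] assms
  unfolding integral_extension_def is_integral_extension_def by blast+


subsection \<open>Cosine families and their generators\<close>

definition cosine_family :: "(real \<Rightarrow> 'a::banach \<Rightarrow> 'a) \<Rightarrow> bool"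
  where "cosine_family Cos \<longleftrightarrow>
    (\<forall>t. bounded_linear (Cos t)) \<and>
    (\<forall>x. Cos 0 x = x) \<and>
    (\<forall>t s x. 2 *\<^sub>R Cos t (Cos s x) = Cos (t + s) x + Cos (t - s) x) \<and>
    (\<forall>x. ((\<lambda>t. Cos t x) \<longlongrightarrow> x) (at 0))"

definition cosine_quotient :: "(real \<Rightarrow> 'a::banach \<Rightarrow> 'a) \<Rightarrow> 'a \<Rightarrow> real \<Rightarrow> 'a"
  where "cosine_quotient Cos x t = (2 / t\<^sup>2) *\<^sub>R (Cos t x - x)"

definition generator_dom :: "(real \<Rightarrow> 'a::banach \<Rightarrow> 'a) \<Rightarrow> 'a set"
  where "generator_dom Cos = {x. \<exists>y. (cosine_quotient Cos x \<longlongrightarrow> y) (at 0)}"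

definition generator :: "(real \<Rightarrow> 'a::banach \<Rightarrow> 'a) \<Rightarrow> 'a \<Rightarrow> 'a"
  where "generator Cos x = Lim (at 0) (cosine_quotient Cos x)"

text \<open>
  \<open>C01_deriv f f'\<close>: \<open>f\<close> is continuously differentiable on \<open>[0,1]\<close> (one-sidedly at the end points)
  with derivative \<open>f' \<in> C[0,1]\<close>.
\<close>

definition C01_deriv :: "C01 \<Rightarrow> C01 \<Rightarrow> bool"
  where "C01_deriv f f' \<longleftrightarrow>
    (\<forall>x\<in>{0..1}. (fn f has_real_derivative fn f' x) (at x within {0..1}))"

definition C_mp :: "real \<Rightarrow> C01 \<Rightarrow> C01"
  where "C_mp t f = of_fn (\<lambda>x. (integral_extension f (x + t) + integral_extension f (x - t)) / 2)"

end

theory Submission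
  imports Defs
begin

text \<open>
  The integral extensions are exactly the continuous functions \<open>F\<close> on the line satisfying, for all
  \<open>t\<close>, the two identities that arise by differentiating \<open>F\<^sub>0\<close> and \<open>F\<^sub>1\<close> of
  \<open>(F(x + t) + F(x - t)) / 2\<close> in \<open>t\<close>. Such an \<open>F\<close> is determined by its values on \<open>[0,1]\<close>, because
  \<open>\<psi>(t) = F(1 + t) - F(1 - t)\<close> solves \<open>\<psi>' = 2\<psi> + 2(F(1 - t) - F(t))\<close>. The identities are linear and
  stable under averaging over the translations by \<open>\<plusminus>t\<close>, which turns uniqueness into d'Alembert's
  equation. For the generator, twice integrating the extension of \<open>f''\<close> gives the extension of \<open>f\<close>
  under the boundary conditions. Conversely, a limit \<open>y\<close> of the cosine quotients is a symmetric second
  derivative of \<open>f\<close>, so \<open>f'' = y\<close> by Schwarz's theorem, and \<open>F\<^sub>0 y = F\<^sub>1 y = 0\<close>, by preservation of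
  the moments, are the boundary conditions.
\<close>

section \<open>Admissible functions\<close>

text \<open>
  \<open>P\<close> is an antiderivative of \<open>F\<close>, so that the last identity reads
  \<open>F(1 + y) - F(1 - y) = \<integral>\<^sub>0\<^sup>1 (F(x + y) - F(x - y)) dx\<close>.
\<close>

definition admissible :: "(real \<Rightarrow> real) \<Rightarrow> (real \<Rightarrow> real) \<Rightarrow> bool"
  where "admissible P F \<longleftrightarrow>
    (\<forall>x. (P has_real_derivative F x) (at x)) \<and> continuous_on UNIV F \<and>
    (\<forall>y. F (1 + y) - F (1 - y) = F y - F (- y)) \<and>
    (\<forall>y. F (1 + y) - F (1 - y) = P (1 + y) - P y - P (1 - y) + P (- y))"

lemma admissibleD:
  assumes "admissible P F"
  shows "(P has_real_derivative F x) (at x)"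
    and "continuous_on UNIV F"
    and "F (1 + y) - F (1 - y) = F y - F (- y)"
    and "F (1 + y) - F (1 - y) = P (1 + y) - P y - P (1 - y) + P (- y)"
  using assms unfolding admissible_def by blast+

lemma DERIV_scaled_shift:
  fixes P :: "real \<Rightarrow> real"
  assumes "\<And>x. (P has_real_derivative F x) (at x)"
  shows "((\<lambda>y. P (c + s * y)) has_real_derivative s * F (c + s * x)) (at x)"
proof -
  have "((\<lambda>y. c + s * y) has_real_derivative s) (at x)"
    by (auto intro!: derivative_eq_intros)
  from DERIV_chain2[OF assms this] show ?thesis by (simp add: mult.commute)
qed

text \<open>Fixed syntactic shapes let \<open>intro\<close> differentiate every shifted or reflected
  term below; this is why the derivatives asserted later keep unsimplified signs such as
  \<open>- (- F (1 - y))\<close>.\<close>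

lemma DERIV_shift_reflect:
  fixes P :: "real \<Rightarrow> real"
  assumes "\<And>x. (P has_real_derivative F x) (at x)"
  shows "((\<lambda>y. P (c + y)) has_real_derivative F (c + x)) (at x)"
    and "((\<lambda>y. P (y + c)) has_real_derivative F (x + c)) (at x)"
    and "((\<lambda>y. P (c - y)) has_real_derivative - F (c - x)) (at x)"
    and "((\<lambda>y. P (y - c)) has_real_derivative F (x - c)) (at x)"
    and "((\<lambda>y. P (- y)) has_real_derivative - F (- x)) (at x)"
  using DERIV_scaled_shift[OF assms, of c 1 x] DERIV_scaled_shift[OF assms, of c "-1" x]
    DERIV_scaled_shift[OF assms, of 0 "-1" x] DERIV_scaled_shift[OF assms, of "-c" 1 x]
  by (simp_all add: add.commute)

lemma admissible_linear:
  assumes "admissible P F" "admissible Q G"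
  shows "admissible (\<lambda>x. a * P x + b * Q x) (\<lambda>x. a * F x + b * G x)"
  unfolding admissible_def
proof (intro conjI allI)
  note F = admissibleD[OF assms(1)] and G = admissibleD[OF assms(2)]
  show "((\<lambda>x. a * P x + b * Q x) has_real_derivative a * F x + b * G x) (at x)" for x
    by (intro DERIV_add DERIV_cmult F(1) G(1))
  show "continuous_on UNIV (\<lambda>x. a * F x + b * G x)"
    by (intro continuous_intros F(2) G(2))
  fix y
  have "a * (F (1 + y) - F (1 - y)) = a * (F y - F (- y))"
    "b * (G (1 + y) - G (1 - y)) = b * (G y - G (- y))"
    by (simp_all only: F(3) G(3))
  then show "a * F (1 + y) + b * G (1 + y) - (a * F (1 - y) + b * G (1 - y)) =
      a * F y + b * G y - (a * F (- y) + b * G (- y))"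
    unfolding right_diff_distrib by linarith
  have "a * (F (1 + y) - F (1 - y)) = a * (P (1 + y) - P y - P (1 - y) + P (- y))"
    "b * (G (1 + y) - G (1 - y)) = b * (Q (1 + y) - Q y - Q (1 - y) + Q (- y))"
    by (simp_all only: F(4) G(4))
  then show "a * F (1 + y) + b * G (1 + y) - (a * F (1 - y) + b * G (1 - y)) =
      a * P (1 + y) + b * Q (1 + y) - (a * P y + b * Q y)
      - (a * P (1 - y) + b * Q (1 - y)) + (a * P (- y) + b * Q (- y))"
    unfolding right_diff_distrib distrib_left by linarith
qed

text \<open>The identities at \<open>y + t\<close> and at \<open>y - t\<close> add up to those for
  the average.\<close>

lemma admissible_average:
  assumes "admissible P F"
  shows "admissible (\<lambda>x. (P (x + t) + P (x - t)) / 2) (\<lambda>x. (F (x + t) + F (x - t)) / 2)"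
  unfolding admissible_def
proof (intro conjI allI)
  note F = admissibleD[OF assms]
  show "((\<lambda>x. (P (x + t) + P (x - t)) / 2) has_real_derivative (F (x + t) + F (x - t)) / 2) (at x)" for x
    by (intro DERIV_cdivide DERIV_add DERIV_shift_reflect F(1))
  show "continuous_on UNIV (\<lambda>x. (F (x + t) + F (x - t)) / 2)"
    by (intro continuous_intros continuous_on_compose2[OF F(2)]) auto
  fix y
  have args: "1 + (y + t) = 1 + y + t" "1 - (y + t) = 1 - y - t" "- (y + t) = - y - t"
    "1 + (y - t) = 1 + y - t" "1 - (y - t) = 1 - y + t" "- (y - t) = - y + t"
    by simp_all
  show "(F (1 + y + t) + F (1 + y - t)) / 2 - (F (1 - y + t) + F (1 - y - t)) / 2 =
      (F (y + t) + F (y - t)) / 2 - (F (- y + t) + F (- y - t)) / 2"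
    using F(3)[of "y + t"] F(3)[of "y - t"] unfolding args by argo
  show "(F (1 + y + t) + F (1 + y - t)) / 2 - (F (1 - y + t) + F (1 - y - t)) / 2 =
      (P (1 + y + t) + P (1 + y - t)) / 2 - (P (y + t) + P (y - t)) / 2
      - (P (1 - y + t) + P (1 - y - t)) / 2 + (P (- y + t) + P (- y - t)) / 2"
    using F(4)[of "y + t"] F(4)[of "y - t"] unfolding args by argo
qed

section \<open>The differential equation and uniqueness\<close>

text \<open>\<open>F\<close> is merely continuous, yet this difference is differentiable, since the
  last identity of \<open>admissible\<close> expresses it through \<open>P\<close>. The other
  identity eliminates \<open>F (- y)\<close>.\<close>

lemma admissible_ode:
  assumes "admissible P F"
  shows "((\<lambda>y. F (1 + y) - F (1 - y)) has_real_derivative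
    2 * (F (1 + y) - F (1 - y)) + 2 * (F (1 - y) - F y)) (at y)"
proof -
  note F = admissibleD[OF assms]
  have "((\<lambda>y. P (1 + y) - P y - P (1 - y) + P (- y)) has_real_derivative
      F (1 + y) - F y - (- F (1 - y)) + (- F (- y))) (at y)"
    by (intro DERIV_add DERIV_diff DERIV_shift_reflect F(1))
  moreover have "F (1 + y) - F y - (- F (1 - y)) + (- F (- y)) =
      2 * (F (1 + y) - F (1 - y)) + 2 * (F (1 - y) - F y)"
    using F(3)[of y] by simp
  ultimately show ?thesis
    unfolding F(4) by (simp only:)
qed

text \<open>Integrating factor \<open>exp (- 2 * y)\<close>: the difference vanishes at 0, and up to
  \<open>n + 1\<close> the forcing term only involves \<open>F\<close> on \<open>[0, n + 1]\<close>
  and \<open>[- n, 1]\<close>, where the bound \<open>c\<close> is given.\<close>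

lemma admissible_bound_step:
  assumes "admissible P F" and le: "\<And>x. x \<in> {- real n..real n + 1} \<Longrightarrow> \<bar>F x\<bar> \<le> c"
    and y: "0 \<le> y" "y \<le> real n + 1"
  shows "\<bar>F (1 + y) - F (1 - y)\<bar> \<le> exp (2 * (real n + 1)) * (4 * (real n + 1)) * c"
proof -
  let ?\<psi> = "\<lambda>y. F (1 + y) - F (1 - y)" and ?d = "\<lambda>y. F (1 - y) - F y"
  have c: "0 \<le> c" using le[of 0] by auto
  have "((\<lambda>y. exp (- 2 * y) * ?\<psi> y) has_real_derivative 2 * exp (- 2 * z) * ?d z) (at z)" for z
    by (rule derivative_eq_intros admissible_ode[OF assms(1)] refl)+ (simp add: algebra_simps)
  moreover have "\<bar>2 * exp (- 2 * z) * ?d z\<bar> \<le> 4 * c" if z: "z \<in> {0..y}" for z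
  proof -
    have "\<bar>F (1 - z)\<bar> \<le> c" "\<bar>F z\<bar> \<le> c" using z y by (auto intro!: le)
    then have "\<bar>?d z\<bar> \<le> 2 * c" by linarith
    moreover have "2 * exp (- 2 * z) \<le> 2" using z by simp
    ultimately have "2 * exp (- 2 * z) * \<bar>?d z\<bar> \<le> 2 * (2 * c)"
      by (intro mult_mono) auto
    then show ?thesis by (simp add: abs_mult)
  qed
  ultimately have "norm (exp (- 2 * y) * ?\<psi> y - exp (- 2 * 0) * ?\<psi> 0) \<le> 4 * c * norm (y - 0)"
    by (intro field_differentiable_bound[where S = "{0..y}"])
       (use y in \<open>auto intro: has_field_derivative_at_within\<close>)
  then have "exp (- 2 * y) * \<bar>?\<psi> y\<bar> \<le> 4 * c * y"
    using y by (simp add: abs_mult)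
  then have "\<bar>?\<psi> y\<bar> \<le> exp (2 * y) * (4 * c * y)"
    by (simp add: exp_minus field_simps)
  also have "\<dots> \<le> exp (2 * (real n + 1)) * (4 * c * (real n + 1))"
    using y c by (intro mult_mono) auto
  finally show ?thesis by (simp add: algebra_simps)
qed

text \<open>\<open>K\<close> depends on \<open>n\<close> alone: the case \<open>c = 0\<close> yields
  uniqueness, and taking a supremum norm for \<open>c\<close> yields boundedness of
  \<open>C_mp t\<close>.\<close>

lemma admissible_bound:
  "\<exists>K\<ge>0. \<forall>P F c. admissible P F \<longrightarrow> (\<forall>x\<in>{0..1}. \<bar>F x\<bar> \<le> c) \<longrightarrow>
    (\<forall>x\<in>{- real n..real n + 1}. \<bar>F x\<bar> \<le> K * c)"
proof (induction n)
  case 0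
  show ?case by (intro exI[of _ 1]) auto
next
  case (Suc n)
  then obtain K where K: "K \<ge> 0" "\<And>P F c x. admissible P F \<Longrightarrow> (\<forall>x\<in>{0..1}. \<bar>F x\<bar> \<le> c) \<Longrightarrow>
      x \<in> {- real n..real n + 1} \<Longrightarrow> \<bar>F x\<bar> \<le> K * c" by metis
  define L where "L = exp (2 * (real n + 1)) * (4 * (real n + 1))"
  have L: "0 \<le> L" by (simp add: L_def)
  show ?case
  proof (intro exI[of _ "K + L * K"] conjI allI impI ballI)
    show "0 \<le> K + L * K" using K(1) L by simp
    fix P F c x
    assume F: "admissible P F" and c: "\<forall>x\<in>{0..1::real}. \<bar>F x\<bar> \<le> c"
      and x: "x \<in> {- real (Suc n)..real (Suc n) + 1}"
    note le = K(2)[OF F c]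
    have c0: "0 \<le> c" using c[rule_format, of 0] by auto
    have LK: "0 \<le> L * (K * c)" using L K(1) c0 by simp
    have step: "\<bar>F (1 + y) - F (1 - y)\<bar> \<le> L * (K * c)" if "0 \<le> y" "y \<le> real n + 1" for y
      unfolding L_def by (rule admissible_bound_step[OF F le that])
    \<comment> \<open>Points to the right of the old window are reflected at 1, points to its left
      at 0. Both land in the window, at the cost of one \<open>step\<close>.\<close>
    consider "x \<in> {- real n..real n + 1}" | "x > real n + 1" | "x < - real n" by fastforce
    then have "\<bar>F x\<bar> \<le> K * c + L * (K * c)"
    proof cases
      case 1
      then show ?thesis using le[OF 1] LK by simp
    next
      case 2
      then have "\<bar>F x - F (2 - x)\<bar> \<le> L * (K * c)" "\<bar>F (2 - x)\<bar> \<le> K * c"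
        using x step[of "x - 1"] le[of "2 - x"] by auto
      then show ?thesis by linarith
    next
      case 3
      then have "\<bar>F (- x) - F x\<bar> \<le> L * (K * c)" "\<bar>F (- x)\<bar> \<le> K * c"
        using x step[of "- x"] le[of "- x"] admissibleD(3)[OF F, of "- x"] by auto
      then show ?thesis by linarith
    qed
    then show "\<bar>F x\<bar> \<le> (K + L * K) * c" by (simp add: algebra_simps)
  qed
qed

lemma admissible_unique:
  assumes "admissible P F" "admissible Q G" "\<And>x. x \<in> {0..1} \<Longrightarrow> F x = G x"
  shows "F = G"
proof
  fix z
  obtain n where n: "\<bar>z\<bar> \<le> real n" using real_arch_simple by blast
  obtain K where "\<And>P F c. admissible P F \<Longrightarrow> (\<forall>x\<in>{0..1}. \<bar>F x\<bar> \<le> c) \<Longrightarrow>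
    (\<forall>x\<in>{- real n..real n + 1}. \<bar>F x\<bar> \<le> K * c)" using admissible_bound by metis
  from this[OF admissible_linear[OF assms(1,2), of 1 "-1"], of 0] assms(3)
  have "\<forall>x\<in>{- real n..real n + 1}. F x = G x" by auto
  moreover have "z \<in> {- real n..real n + 1}" using n by auto
  ultimately show "F z = G z" by blast
qed

lemma antiderivative_UNIV:
  fixes f :: "real \<Rightarrow> real"
  assumes "continuous_on UNIV f"
  obtains F where "\<And>x. (F has_real_derivative f x) (at x)"
proof -
  have "isCont f x" for x using assms by (simp add: continuous_on_eq_continuous_at)
  then obtain F where "\<forall>x. - \<infinity> < ereal x \<longrightarrow> ereal x < \<infinity> \<longrightarrow> (F has_vector_derivative f x) (at x)"
    using einterval_antiderivative[of "-\<infinity>" \<infinity> f] by auto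
  then show thesis
    using that[of F] by (simp add: has_real_derivative_iff_has_vector_derivative)
qed

section \<open>The integral extension is admissible\<close>

text \<open>Each unit interval carries one continuous piece. The pieces agree at common end points
  because they restrict a single function, so gluing along closed sets applies.\<close>

lemma continuous_on_integral_extension: "continuous_on UNIV (integral_extension f)"
proof -
  let ?F = "integral_extension f"
  have g: "continuous_on {real n..real n + 1} ?F" for n
  proof (rule continuous_on_eq)
    show "continuous_on {real n..real n + 1} (\<lambda>x. fn (ext_g f n) (x - real n))"
      by (intro continuous_on_compose2[OF continuous_on_fn] continuous_intros) auto
    show "fn (ext_g f n) (x - real n) = ?F x" if "x \<in> {real n..real n + 1}" for x
      using integral_extension(1)[of "x - real n" f n] that by auto
  qed
  have h: "continuous_on {- real n..1 - real n} ?F" for n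
  proof (rule continuous_on_eq)
    show "continuous_on {- real n..1 - real n} (\<lambda>x. fn (ext_h f n) (1 - real n - x))"
      by (intro continuous_on_compose2[OF continuous_on_fn] continuous_intros) auto
    show "fn (ext_h f n) (1 - real n - x) = ?F x" if "x \<in> {- real n..1 - real n}" for x
      using integral_extension(2)[of "1 - real n - x" f n] that by auto
  qed
  have c: "continuous_on {- real n..real n + 1} ?F" for n
  proof (induction n)
    case 0
    show ?case using g[of 0] by simp
  next
    case (Suc n)
    have "{- real (Suc n)..real (Suc n) + 1} =
      {- real (Suc n)..1 - real (Suc n)} \<union> ({- real n..real n + 1} \<union> {real (Suc n)..real (Suc n) + 1})"
      by auto
    then show ?case
      by (simp only:) (intro continuous_on_closed_Un closed_Un closed_atLeastAtMost Suc g h)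
  qed
  have "isCont ?F x" for x
  proof -
    obtain n where n: "\<bar>x\<bar> < real n" using reals_Archimedean2 by blast
    then have "x \<in> {- real n<..<real n + 1}" by auto
    moreover have "continuous_on {- real n<..<real n + 1} ?F"
      by (rule continuous_on_subset[OF c[of n]]) auto
    ultimately show ?thesis by (simp add: continuous_on_eq_continuous_at)
  qed
  then show ?thesis by (simp add: continuous_on_eq_continuous_at)
qed

text \<open>Variation of constants: this is the equation of \<open>admissible_ode\<close>, which
  ties the recursion to admissibility.\<close>

lemma psi_deriv:
  assumes x: "x \<in> {0..1}"
  shows "(fn (psi d) has_real_derivative 2 * fn (psi d) x + 2 * fn d x) (at x within {0..1})"
proof -
  let ?P = "\<lambda>x. exp (2 * x) * (2 * integral {0..x} (\<lambda>y. exp (- 2 * y) * fn d y) - integral {0..1} (fn d))"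
  have I: "((\<lambda>x. integral {0..x} (\<lambda>y. exp (- 2 * y) * fn d y)) has_real_derivative
      exp (- 2 * x) * fn d x) (at x within {0..1})"
    by (rule integral_has_real_derivative[OF _ x]) (intro continuous_intros continuous_on_fn)
  have "(?P has_real_derivative 2 * ?P x + 2 * fn d x) (at x within {0..1})"
    by (rule derivative_eq_intros I refl)+ (simp add: algebra_simps exp_minus)
  then show ?thesis
    by (rule has_field_derivative_transform_within[OF _ zero_less_one x, THEN DERIV_cong])
       (use x in \<open>simp_all add: psi_formula\<close>)
qed

text \<open>The recursion transported to the line: stage \<open>n\<close> supplies the values of
  \<open>F\<close> at \<open>y\<close> and \<open>1 - y\<close>, stage \<open>n + 1\<close> those at
  \<open>1 + y\<close> and \<open>- y\<close>.\<close>

lemma integral_extension_psi: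
  fixes f n
  defines "d \<equiv> ext_h f n - ext_g f n" and "F \<equiv> integral_extension f"
  assumes "x \<in> {0..1}" and y: "y = x + real n"
  shows "F (1 + y) - F (1 - y) = fn (psi d) x" and "F y - F (- y) = fn (psi d) x"
    and "F (1 - y) - F y = fn d x"
proof -
  have *: "F y = fn (ext_g f n) x" "F (1 - y) = fn (ext_h f n) x"
    "F (1 + y) = fn (ext_g f (Suc n)) x" "F (- y) = fn (ext_h f (Suc n)) x"
    using integral_extension[OF assms(3), of f n] integral_extension[OF assms(3), of f "Suc n"]
    by (simp_all add: F_def y algebra_simps)
  show "F (1 + y) - F (1 - y) = fn (psi d) x" "F y - F (- y) = fn (psi d) x"
    "F (1 - y) - F y = fn d x"
    unfolding * ext_Suc d_def[symmetric] by (simp_all add: d_def)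
qed

lemma integral_extension_symmetric:
  fixes f defines "F \<equiv> integral_extension f"
  shows "F (1 + y) - F (1 - y) = F y - F (- y)"
proof -
  have *: "F (1 + y) - F (1 - y) = F y - F (- y)" if "0 \<le> y" for y
  proof -
    have "frac y \<in> {0..1}" "y = frac y + real (nat \<lfloor>y\<rfloor>)"
      using that frac_lt_1[of y] by (auto simp: frac_def)
    then show ?thesis unfolding F_def by (metis integral_extension_psi(1,2))
  qed
  \<comment> \<open>The identity is odd in \<open>y\<close>, so nonnegative arguments
    suffice.\<close>
  show ?thesis
    using *[of y] *[of "- y"] by (cases "0 \<le> y") auto
qed

text \<open>It remains to show that the residual \<open>?R\<close> of the last identity vanishes.
  Both sides of that identity have the same derivative on each unit interval, so \<open>?R\<close>
  is constant there.\<close>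

lemma admissible_integral_extension: "\<exists>P. admissible P (integral_extension f)"
proof -
  let ?F = "integral_extension f"
  obtain P where P: "\<And>x. (P has_real_derivative ?F x) (at x)"
    using antiderivative_UNIV[OF continuous_on_integral_extension] by blast
  let ?J = "\<lambda>y. P (1 + y) - P y - P (1 - y) + P (- y)"
  let ?R = "\<lambda>y. ?F (1 + y) - ?F (1 - y) - ?J y"
  have J: "(?J has_real_derivative 2 * (?F (1 + y) - ?F (1 - y)) + 2 * (?F (1 - y) - ?F y)) (at y)" for y
  proof -
    have "(?J has_real_derivative ?F (1 + y) - ?F y - (- ?F (1 - y)) + (- ?F (- y))) (at y)"
      by (intro DERIV_add DERIV_diff DERIV_shift_reflect P)
    then show ?thesis
      by (rule DERIV_cong) (use integral_extension_symmetric[of f y] in simp)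
  qed
  have const: "?R (x + real n) = ?R (real n)" if x: "x \<in> {0..1}" for x n
  proof -
    let ?d = "ext_h f n - ext_g f n"
    let ?S = "\<lambda>x. fn (psi ?d) x - ?J (x + real n)"
    have "(?S has_real_derivative 0) (at z within {0..1})" if z: "z \<in> {0..1}" for z
    proof -
      have "((\<lambda>z. ?J (z + real n)) has_real_derivative 2 * fn (psi ?d) z + 2 * fn ?d z) (at z within {0..1})"
        using DERIV_shift_reflect(2)[OF J, of "real n" z] integral_extension_psi[OF z refl, of f n]
        by (auto intro: has_field_derivative_at_within)
      from DERIV_diff[OF psi_deriv[OF z, of ?d] this] show ?thesis by simp
    qed
    then obtain c where c: "\<And>z. z \<in> {0..1} \<Longrightarrow> ?S z = c"
      using has_field_derivative_zero_constant[of "{0..1}" ?S] by auto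
    have "?S x = ?S 0" using c[OF x] c[of 0] by simp
    then show ?thesis
      using integral_extension_psi(1)[OF x refl, of f n] integral_extension_psi(1)[of 0 "real n" n f]
      by simp
  qed
  \<comment> \<open>Consecutive unit intervals share an end point, so the value 0 at the origin is
    passed on.\<close>
  have "?R (real n) = 0" for n
  proof (induction n)
    case (Suc n)
    then show ?case using const[of 1 n] by (simp add: add.commute)
  qed simp
  then have R: "?R y = 0" if "0 \<le> y" for y
  proof -
    have "frac y \<in> {0..1}" "y = frac y + real (nat \<lfloor>y\<rfloor>)"
      using that frac_lt_1[of y] by (auto simp: frac_def)
    then show ?thesis using const \<open>\<And>n. ?R (real n) = 0\<close> by metis
  qed
  \<comment> \<open>\<open>?R\<close> is odd, which covers negative \<open>y\<close>.\<close>
  have "?F (1 + y) - ?F (1 - y) = ?J y" for y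
    using R[of y] R[of "- y"] by (cases "0 \<le> y") auto
  then have "admissible P ?F"
    unfolding admissible_def
    using P continuous_on_integral_extension integral_extension_symmetric by blast
  then show ?thesis by blast
qed

lemma integral_extension_eq: "x \<in> {0..1} \<Longrightarrow> integral_extension f x = fn f x"
  using integral_extension(1)[of x f 0] by (simp add: ext_0)

text \<open>Later formulas for extensions are obtained by exhibiting an admissible function with the
  right values on \<open>[0,1]\<close>, without returning to the recursion.\<close>

lemma integral_extension_unique:
  assumes "admissible P F" "\<And>x. x \<in> {0..1} \<Longrightarrow> F x = fn f x"
  shows "integral_extension f = F"
proof -
  obtain P' where "admissible P' (integral_extension f)" using admissible_integral_extension by blast
  from admissible_unique[OF this assms(1)] show ?thesis by (simp add: integral_extension_eq assms(2))
qed

section \<open>The cosine family\<close>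

lemma fn_C_mp:
  assumes "x \<in> {0..1}"
  shows "fn (C_mp t f) x = (integral_extension f (x + t) + integral_extension f (x - t)) / 2"
proof -
  have c: "continuous_on {0..1} (\<lambda>x. integral_extension f (x + s))" for s
    by (rule continuous_on_compose2[OF continuous_on_integral_extension]) (auto intro: continuous_intros)
  have "continuous_on {0..1} (\<lambda>x. (integral_extension f (x + t) + integral_extension f (x + - t)) / 2)"
    by (intro continuous_on_divide continuous_on_add continuous_on_const c) simp
  then show ?thesis
    unfolding C_mp_def by (intro fn_of_fn assms) simp
qed

text \<open>The average is admissible and agrees with \<open>C_mp t f\<close> on
  \<open>[0,1]\<close>. This makes products of the operators computable.\<close>

lemma integral_extension_C_mp:
  "integral_extension (C_mp t f) =
    (\<lambda>x. (integral_extension f (x + t) + integral_extension f (x - t)) / 2)"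
proof -
  obtain P where "admissible P (integral_extension f)" using admissible_integral_extension by blast
  from admissible_average[OF this] show ?thesis
    by (rule integral_extension_unique) (simp add: fn_C_mp)
qed

lemma fn_scaleR: "fn (c *\<^sub>R f) x = c * fn f x"
  by (simp add: fn_def)

lemma integral_extension_linear:
  "integral_extension (a *\<^sub>R f + b *\<^sub>R g) =
    (\<lambda>x. a * integral_extension f x + b * integral_extension g x)"
proof -
  obtain P Q where "admissible P (integral_extension f)" "admissible Q (integral_extension g)"
    using admissible_integral_extension by metis
  from admissible_linear[OF this] show ?thesis
    by (rule integral_extension_unique) (simp add: fn_scaleR integral_extension_eq)
qed

lemma abs_fn_le_norm: "\<bar>fn f x\<bar> \<le> norm f"
  using norm_bounded[of f "ui_of_real x"] by (simp add: fn_def)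

lemma norm_le_fn:
  assumes "\<And>x. x \<in> {0..1} \<Longrightarrow> \<bar>fn f x\<bar> \<le> c"
  shows "norm f \<le> c"
proof (rule norm_bound)
  fix u
  show "norm (apply_bcontfun f u) \<le> c"
    using assms[OF real_of_ui_in[of u]] by (simp add: fn_def real_of_ui_inverse)
qed

text \<open>For \<open>x\<close> in \<open>[0,1]\<close> the points \<open>x + t\<close> and
  \<open>x - t\<close> stay in \<open>[- n, n + 1]\<close>, where \<open>admissible_bound\<close>
  controls the extension by the norm of \<open>f\<close>.\<close>

lemma bounded_linear_C_mp: "bounded_linear (C_mp t)"
proof -
  obtain n where n: "\<bar>t\<bar> \<le> real n" using real_arch_simple by blast
  obtain K where K: "\<And>P F c. admissible P F \<Longrightarrow> (\<forall>x\<in>{0..1}. \<bar>F x\<bar> \<le> c) \<Longrightarrow>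
    (\<forall>x\<in>{- real n..real n + 1}. \<bar>F x\<bar> \<le> K * c)" using admissible_bound by metis
  show ?thesis
  proof (rule bounded_linear_intro)
    show "C_mp t (f + g) = C_mp t f + C_mp t g" for f g
      using integral_extension_linear[of 1 f 1 g]
      by (intro fn_eqI) (simp add: fn_C_mp field_simps)
    show "C_mp t (r *\<^sub>R f) = r *\<^sub>R C_mp t f" for r f
      using integral_extension_linear[of r f 0 f]
      by (intro fn_eqI) (simp add: fn_C_mp fn_scaleR field_simps)
    fix f
    obtain P where "admissible P (integral_extension f)" using admissible_integral_extension by blast
    from K[OF this, of "norm f"]
    have le: "\<bar>integral_extension f x\<bar> \<le> K * norm f" if "x \<in> {- real n..real n + 1}" for x
      using that by (simp add: integral_extension_eq abs_fn_le_norm)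
    show "norm (C_mp t f) \<le> norm f * K"
    proof (rule norm_le_fn)
      fix x :: real assume x: "x \<in> {0..1}"
      have "\<bar>integral_extension f (x + t)\<bar> \<le> K * norm f" "\<bar>integral_extension f (x - t)\<bar> \<le> K * norm f"
        using x n by (auto intro!: le)
      then show "\<bar>fn (C_mp t f) x\<bar> \<le> norm f * K"
        unfolding fn_C_mp[OF x] by (simp add: mult.commute)
    qed
  qed
qed

lemma continuous_uniform_shift:
  fixes F :: "real \<Rightarrow> real"
  assumes "continuous_on UNIV F" "0 < e"
  obtains \<delta> where "0 < \<delta>" "\<And>x s. x \<in> {0..1} \<Longrightarrow> \<bar>s\<bar> < \<delta> \<Longrightarrow> \<bar>F (x + s) - F x\<bar> < e"
proof -
  have "uniformly_continuous_on {-1..2} F"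
    by (intro compact_uniformly_continuous continuous_on_subset[OF assms(1)]) auto
  then obtain d where d: "0 < d"
    "\<And>x y. x \<in> {-1..2} \<Longrightarrow> y \<in> {-1..2} \<Longrightarrow> dist y x < d \<Longrightarrow> dist (F y) (F x) < e"
    using \<open>0 < e\<close> unfolding uniformly_continuous_on_def by metis
  \<comment> \<open>The cap 1 keeps \<open>x + s\<close> in \<open>[-1, 2]\<close>, the compact set
    that carries uniform continuity.\<close>
  show thesis
  proof (rule that[of "min d 1"])
    fix x s :: real assume *: "x \<in> {0..1}" "\<bar>s\<bar> < min d 1"
    then have "x + s \<in> {-1..2}" by auto
    then show "\<bar>F (x + s) - F x\<bar> < e" using d(2)[of x "x + s"] * by (auto simp: dist_real_def)
  qed (use d in auto)
qed

lemma C_mp_tendsto: "((\<lambda>t. C_mp t f) \<longlongrightarrow> f) (at 0)"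
proof (rule tendstoI)
  fix e :: real assume "0 < e"
  then obtain \<delta> where \<delta>: "0 < \<delta>" "\<And>x s. x \<in> {0..1} \<Longrightarrow> \<bar>s\<bar> < \<delta> \<Longrightarrow>
      \<bar>integral_extension f (x + s) - integral_extension f x\<bar> < e / 2"
    using continuous_uniform_shift[OF continuous_on_integral_extension, of "e / 2"] by (metis half_gt_zero)
  have "dist (C_mp t f) f < e" if "\<bar>t\<bar> < \<delta>" for t
  proof -
    have "norm (C_mp t f - f) \<le> e / 2"
    proof (rule norm_le_fn)
      fix x :: real assume x: "x \<in> {0..1}"
      have "\<bar>integral_extension f (x + t) - fn f x\<bar> < e / 2"
        "\<bar>integral_extension f (x - t) - fn f x\<bar> < e / 2"
        using \<delta>(2)[OF x, of t] \<delta>(2)[OF x, of "- t"] that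
        by (simp_all add: integral_extension_eq[OF x])
      then show "\<bar>fn (C_mp t f - f) x\<bar> \<le> e / 2"
        unfolding fn_diff fn_C_mp[OF x] by argo
    qed
    then show ?thesis using \<open>0 < e\<close> by (simp add: dist_norm)
  qed
  then show "\<forall>\<^sub>F t in at 0. dist (C_mp t f) f < e"
    unfolding eventually_at using \<delta>(1) by (intro exI[of _ \<delta>]) auto
qed

lemma C_mp_0: "C_mp 0 f = f"
  by (intro fn_eqI) (simp add: fn_C_mp integral_extension_eq)

lemma cosine_family_C_mp: "cosine_family C_mp"
  unfolding cosine_family_def
proof (intro conjI allI)
  \<comment> \<open>Averaging twice produces the values of the extension of \<open>f\<close> at
    distance \<open>t + s\<close> and \<open>t - s\<close> on both sides of
    \<open>x\<close>.\<close>
  show "2 *\<^sub>R C_mp t (C_mp s f) = C_mp (t + s) f + C_mp (t - s) f" for t s f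
    by (intro fn_eqI) (simp add: fn_C_mp fn_scaleR integral_extension_C_mp algebra_simps add_divide_distrib)
qed (rule bounded_linear_C_mp C_mp_0 C_mp_tendsto)+

section \<open>Preservation of the moments\<close>

lemma integral_eq_antiderivative:
  fixes P :: "real \<Rightarrow> real"
  assumes "\<And>x. (P has_real_derivative F x) (at x)"
  shows "integral {0..1} F = P 1 - P 0"
proof -
  have "(F has_integral P 1 - P 0) {0..1}"
    by (rule fundamental_theorem_of_calculus)
       (use assms in \<open>auto simp: has_real_derivative_iff_has_vector_derivative[symmetric]
          intro: has_field_derivative_at_within\<close>)
  then show ?thesis by (rule integral_unique)
qed

lemma DERIV_0_eq:
  fixes r :: "real \<Rightarrow> real"
  assumes "\<And>x. (r has_real_derivative 0) (at x)"
  shows "r t = r 0"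
  by (rule DERIV_isconst_all[of r t 0]) (use assms in blast)

text \<open>Through \<open>P\<close> the moment becomes an explicit function of \<open>t\<close>,
  whose derivative vanishes by the identity of \<open>admissible\<close> free of
  \<open>P\<close>.\<close>

lemma moment_0_C_mp: "moment 0 (C_mp t f) = moment 0 f"
proof -
  let ?F = "integral_extension f"
  obtain P where "admissible P ?F" using admissible_integral_extension by blast
  note F = admissibleD[OF this]
  let ?m = "\<lambda>t. (P (1 + t) + P (1 - t)) / 2 - (P t + P (- t)) / 2"
  have m: "moment 0 (C_mp t f) = ?m t" for t
  proof -
    have "moment 0 (C_mp t f) = integral {0..1} (\<lambda>x. (?F (x + t) + ?F (x - t)) / 2)"
      unfolding moment_def by (rule integral_cong) (simp add: fn_C_mp)
    also have "\<dots> = (P (1 + t) + P (1 - t)) / 2 - (P (0 + t) + P (0 - t)) / 2"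
      by (rule integral_eq_antiderivative) (intro DERIV_cdivide DERIV_add DERIV_shift_reflect F(1))
    finally show ?thesis by simp
  qed
  have "(?m has_real_derivative (?F (1 + t) + - ?F (1 - t)) / 2 - (?F t + - ?F (- t)) / 2) (at t)" for t
    by (intro DERIV_cdivide DERIV_add DERIV_diff DERIV_shift_reflect F(1))
  then have "(?m has_real_derivative 0) (at t)" for t
    by (rule DERIV_cong) (use F(3)[of t] in simp)
  then have "?m t = ?m 0" by (rule DERIV_0_eq)
  then show ?thesis
    unfolding m[symmetric] by (simp only: C_mp_0)
qed

text \<open>Same plan; the weight \<open>x\<close> brings in a second antiderivative
  \<open>Q\<close> by parts, and the derivative in \<open>t\<close> vanishes by the identity
  involving \<open>P\<close>.\<close>

lemma moment_1_C_mp: "moment 1 (C_mp t f) = moment 1 f"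
proof -
  let ?F = "integral_extension f"
  obtain P where "admissible P ?F" using admissible_integral_extension by blast
  note F = admissibleD[OF this]
  have "continuous_on UNIV P"
    using F(1) by (meson DERIV_isCont continuous_at_imp_continuous_on)
  then obtain Q where Q: "\<And>x. (Q has_real_derivative P x) (at x)"
    using antiderivative_UNIV by blast
  let ?m = "\<lambda>t. ((P (1 + t) + P (1 - t)) - (Q (1 + t) + Q (1 - t)) + (Q t + Q (- t))) / 2"
  have m: "moment 1 (C_mp t f) = ?m t" for t
  proof -
    let ?A = "\<lambda>x. (x * (P (x + t) + P (x - t)) - (Q (x + t) + Q (x - t))) / 2"
    have "(?A has_real_derivative x * ((?F (x + t) + ?F (x - t)) / 2)) (at x)" for x
    proof -
      have "(?A has_real_derivative (1 * (P (x + t) + P (x - t)) + (?F (x + t) + ?F (x - t)) * x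
          - (P (x + t) + P (x - t))) / 2) (at x)"
        by (intro DERIV_cdivide DERIV_add DERIV_diff DERIV_mult DERIV_ident DERIV_shift_reflect F(1) Q)
      then show ?thesis by (rule DERIV_cong) (simp add: field_simps)
    qed
    then have "integral {0..1} (\<lambda>x. x * ((?F (x + t) + ?F (x - t)) / 2)) = ?A 1 - ?A 0"
      by (rule integral_eq_antiderivative)
    moreover have "moment 1 (C_mp t f) = integral {0..1} (\<lambda>x. x * ((?F (x + t) + ?F (x - t)) / 2))"
      unfolding moment_def by (rule integral_cong) (simp add: fn_C_mp)
    ultimately show ?thesis by (simp add: field_simps)
  qed
  have "(?m has_real_derivative ((?F (1 + t) + - ?F (1 - t)) - (P (1 + t) + - P (1 - t))
      + (P t + - P (- t))) / 2) (at t)" for t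
    by (intro DERIV_cdivide DERIV_add DERIV_diff DERIV_shift_reflect F(1) Q)
  then have "(?m has_real_derivative 0) (at t)" for t
    by (rule DERIV_cong) (use F(4)[of t] in simp)
  then have "?m t = ?m 0" by (rule DERIV_0_eq)
  then show ?thesis
    unfolding m[symmetric] by (simp only: C_mp_0)
qed

section \<open>Second differences\<close>

text \<open>Mean value inequality applied twice: the remainder \<open>r\<close> and its derivative
  \<open>q\<close> vanish at 0, and the derivative of \<open>q\<close> is at most
  \<open>2 * e\<close> in absolute value. An interval symmetric about 0 handles both signs of
  \<open>t\<close>.\<close>

lemma second_difference_bound:
  fixes G H W :: "real \<Rightarrow> real"
  assumes G: "\<And>x. (G has_real_derivative H x) (at x)" and H: "\<And>x. (H has_real_derivative W x) (at x)"
    and W: "\<And>s. \<bar>s\<bar> \<le> \<bar>t\<bar> \<Longrightarrow> \<bar>W (x + s) - W x\<bar> \<le> e"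
  shows "\<bar>G (x + t) + G (x - t) - 2 * G x - t\<^sup>2 * W x\<bar> \<le> 2 * e * t\<^sup>2"
proof -
  define q where "q s = H (x + s) - H (x - s) - 2 * s * W x" for s
  define r where "r s = G (x + s) + G (x - s) - (2 * G x + s\<^sup>2 * W x)" for s
  have e: "0 \<le> e" using W[of 0] by simp
  have q': "(q has_real_derivative W (x + s) + W (x - s) - 2 * W x) (at s)" for s
  proof -
    have "(q has_real_derivative W (x + s) - (- W (x - s)) - 2 * W x) (at s)"
      unfolding q_def by (intro DERIV_diff DERIV_shift_reflect H) (auto intro!: derivative_eq_intros)
    then show ?thesis by simp
  qed
  have r': "(r has_real_derivative q s) (at s)" for s
  proof -
    have "((\<lambda>s. G (x + s) + G (x - s)) has_real_derivative H (x + s) + (- H (x - s))) (at s)"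
      by (intro DERIV_add DERIV_shift_reflect G)
    moreover have "((\<lambda>s. 2 * G x + s\<^sup>2 * W x) has_real_derivative 2 * s * W x) (at s)"
      by (auto intro!: derivative_eq_intros)
    ultimately have "(r has_real_derivative H (x + s) + (- H (x - s)) - 2 * s * W x) (at s)"
      unfolding r_def by (rule DERIV_diff)
    then show ?thesis by (simp add: q_def)
  qed
  have q: "\<bar>q s\<bar> \<le> 2 * e * \<bar>t\<bar>" if s: "\<bar>s\<bar> \<le> \<bar>t\<bar>" for s
  proof -
    have "norm (q s - q 0) \<le> 2 * e * norm (s - 0)"
    proof (rule field_differentiable_bound[where S = "{- \<bar>t\<bar>..\<bar>t\<bar>}"])
      fix z assume "z \<in> {- \<bar>t\<bar>..\<bar>t\<bar>}"
      then have "\<bar>W (x + z) - W x\<bar> \<le> e" "\<bar>W (x - z) - W x\<bar> \<le> e"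
        using W[of z] W[of "- z"] by auto
      then show "norm (W (x + z) + W (x - z) - 2 * W x) \<le> 2 * e" by simp
    qed (use s in \<open>auto intro: has_field_derivative_at_within[OF q']\<close>)
    then have "\<bar>q s\<bar> \<le> 2 * e * \<bar>s\<bar>" by (simp add: q_def)
    also have "\<dots> \<le> 2 * e * \<bar>t\<bar>" using s e by (intro mult_left_mono) auto
    finally show ?thesis .
  qed
  have "norm (r t - r 0) \<le> 2 * e * \<bar>t\<bar> * norm (t - 0)"
    by (rule field_differentiable_bound[where S = "{- \<bar>t\<bar>..\<bar>t\<bar>}"])
       (auto intro: has_field_derivative_at_within[OF r'] q)
  then show ?thesis by (simp add: r_def power2_eq_square abs_mult_self_eq mult.assoc)
qed

lemma second_difference_quotient_bound:
  fixes G H W :: "real \<Rightarrow> real"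
  assumes "\<And>x. (G has_real_derivative H x) (at x)" "\<And>x. (H has_real_derivative W x) (at x)"
    and "\<And>s. \<bar>s\<bar> \<le> \<bar>t\<bar> \<Longrightarrow> \<bar>W (x + s) - W x\<bar> \<le> e" and "t \<noteq> 0"
  shows "\<bar>(G (x + t) + G (x - t) - 2 * G x) / t\<^sup>2 - W x\<bar> \<le> 2 * e"
proof -
  have "(G (x + t) + G (x - t) - 2 * G x) / t\<^sup>2 - W x =
      (G (x + t) + G (x - t) - 2 * G x - t\<^sup>2 * W x) / t\<^sup>2"
    using assms(4) by (simp add: field_simps)
  moreover have "\<bar>G (x + t) + G (x - t) - 2 * G x - t\<^sup>2 * W x\<bar> \<le> 2 * e * t\<^sup>2"
    by (rule second_difference_bound[OF assms(1-3)])
  ultimately show ?thesis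
    using assms(4) by (simp only: abs_divide abs_power2) (simp add: pos_divide_le_eq)
qed

lemma second_difference_tendsto:
  fixes G H W :: "real \<Rightarrow> real"
  assumes "\<And>x. (G has_real_derivative H x) (at x)" "\<And>x. (H has_real_derivative W x) (at x)"
    and W: "continuous_on UNIV W"
  shows "((\<lambda>t. (G (x + t) + G (x - t) - 2 * G x) / t\<^sup>2) \<longlongrightarrow> W x) (at 0)"
proof (rule tendstoI)
  fix e :: real assume e: "0 < e"
  have "isCont W x" using W by (simp add: continuous_on_eq_continuous_at)
  \<comment> \<open>The quotient bound doubles this to \<open>2 * e / 3\<close>, which is still
    strictly below \<open>e\<close>.\<close>
  then obtain d where d: "0 < d" "\<And>y. dist y x < d \<Longrightarrow> dist (W y) (W x) < e / 3"
    using e unfolding continuous_at_eps_delta dist_real_def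
    by (metis zero_less_divide_iff zero_less_numeral)
  have "dist ((G (x + t) + G (x - t) - 2 * G x) / t\<^sup>2) (W x) < e" if "t \<noteq> 0" "\<bar>t\<bar> < d" for t
  proof -
    have "\<bar>W (x + s) - W x\<bar> \<le> e / 3" if "\<bar>s\<bar> \<le> \<bar>t\<bar>" for s
      using d(2)[of "x + s"] that \<open>\<bar>t\<bar> < d\<close> by (simp add: dist_real_def)
    from second_difference_quotient_bound[OF assms(1,2) this that(1)] show ?thesis
      using e by (simp add: dist_real_def)
  qed
  then show "\<forall>\<^sub>F t in at 0. dist ((G (x + t) + G (x - t) - 2 * G x) / t\<^sup>2) (W x) < e"
    unfolding eventually_at using d(1) by (intro exI[of _ d]) auto
qed

text \<open>
  A positive value of \<open>\<phi>\<close> would survive in \<open>\<phi> - \<epsilon>(x - a)(b - x)\<close>, whose symmetric second derivative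
  \<open>2\<epsilon>\<close> is incompatible with an interior maximum.
\<close>

lemma Schwarz_second_difference_le:
  fixes \<phi> :: "real \<Rightarrow> real"
  assumes cont: "continuous_on {a..b} \<phi>" and ends: "\<phi> a \<le> 0" "\<phi> b \<le> 0"
    and lim: "\<And>x. x \<in> {a<..<b} \<Longrightarrow> ((\<lambda>t. (\<phi> (x + t) + \<phi> (x - t) - 2 * \<phi> x) / t\<^sup>2) \<longlongrightarrow> 0) (at 0)"
    and c: "c \<in> {a..b}"
  shows "\<phi> c \<le> 0"
proof (rule ccontr)
  assume neg: "\<not> \<phi> c \<le> 0"
  then have ab: "a < c" "c < b" using c ends by (auto simp: le_less)
  \<comment> \<open>Chosen so that the parabola removes exactly half of \<open>\<phi> c\<close>,
    which keeps \<open>\<theta> c\<close> positive.\<close>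
  define \<epsilon> where "\<epsilon> = \<phi> c / (2 * ((c - a) * (b - c)))"
  have \<epsilon>: "0 < \<epsilon>" using neg ab by (simp add: \<epsilon>_def)
  define \<theta> where "\<theta> x = \<phi> x - \<epsilon> * ((x - a) * (b - x))" for x
  have "continuous_on {a..b} \<theta>"
    unfolding \<theta>_def by (intro continuous_intros cont)
  then obtain m where m: "m \<in> {a..b}" "\<And>x. x \<in> {a..b} \<Longrightarrow> \<theta> x \<le> \<theta> m"
    using continuous_attains_sup[of "{a..b}" \<theta>] ab by fastforce
  have "(c - a) * (b - c) \<noteq> 0" using ab by simp
  then have "\<epsilon> * ((c - a) * (b - c)) = \<phi> c / 2" by (simp add: \<epsilon>_def)
  then have "0 < \<theta> c" using neg by (simp add: \<theta>_def)
  then have "0 < \<theta> m" using m(2)[OF c] by simp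
  \<comment> \<open>At the end points \<open>\<theta>\<close> equals \<open>\<phi>\<close>, hence is
    at most 0, so a positive maximum is interior.\<close>
  then have m': "a < m" "m < b" using m(1) ends by (auto simp: \<theta>_def le_less)
  then have "\<forall>\<^sub>F t in at 0. dist ((\<phi> (m + t) + \<phi> (m - t) - 2 * \<phi> m) / t\<^sup>2) 0 < 2 * \<epsilon>"
    using \<epsilon> by (intro tendstoD[OF lim]) auto
  then obtain d where d: "0 < d"
    "\<And>t. t \<noteq> 0 \<Longrightarrow> \<bar>t\<bar> < d \<Longrightarrow> \<bar>(\<phi> (m + t) + \<phi> (m - t) - 2 * \<phi> m) / t\<^sup>2\<bar> < 2 * \<epsilon>"
    unfolding eventually_at by (auto simp: dist_real_def)
  \<comment> \<open>Below \<open>d\<close>, and small enough for \<open>m + t\<close> and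
    \<open>m - t\<close> to lie in \<open>[a,b]\<close>, where \<open>m\<close> is maximal.\<close>
  define t where "t = min (d / 2) (min (m - a) (b - m))"
  have t: "0 < t" "t < d" "t \<le> m - a" "t \<le> b - m"
    using d(1) m' by (auto simp: t_def)
  have "\<theta> (m + t) + \<theta> (m - t) - 2 * \<theta> m \<le> 0"
    using m(2)[of "m + t"] m(2)[of "m - t"] t m' by auto
  \<comment> \<open>The second difference of \<open>(x - a) * (b - x)\<close> is exactly
    \<open>- 2 * t\<^sup>2\<close>.\<close>
  moreover have "\<theta> (m + t) + \<theta> (m - t) - 2 * \<theta> m =
      \<phi> (m + t) + \<phi> (m - t) - 2 * \<phi> m + 2 * \<epsilon> * t\<^sup>2"
    by (simp add: \<theta>_def algebra_simps power2_eq_square)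
  ultimately have "(\<phi> (m + t) + \<phi> (m - t) - 2 * \<phi> m) / t\<^sup>2 \<le> - 2 * \<epsilon>"
    using t(1) by (simp add: divide_le_eq)
  moreover have "\<bar>(\<phi> (m + t) + \<phi> (m - t) - 2 * \<phi> m) / t\<^sup>2\<bar> < 2 * \<epsilon>"
    using t by (intro d(2)) auto
  ultimately show False by linarith
qed

text \<open>Subtracting the chord gives zero end values and leaves second differences unchanged; the
  one-sided lemma then applies to both signs.\<close>

lemma Schwarz_second_difference:
  fixes \<phi> :: "real \<Rightarrow> real"
  assumes cont: "continuous_on {a..b} \<phi>"
    and lim: "\<And>x. x \<in> {a<..<b} \<Longrightarrow> ((\<lambda>t. (\<phi> (x + t) + \<phi> (x - t) - 2 * \<phi> x) / t\<^sup>2) \<longlongrightarrow> 0) (at 0)"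
    and x: "x \<in> {a..b}"
  shows "\<phi> x = \<phi> a + (\<phi> b - \<phi> a) / (b - a) * (x - a)"
proof (cases "a < b")
  case True
  define k where "k = (\<phi> b - \<phi> a) / (b - a)"
  define \<psi> where "\<psi> x = \<phi> x - (\<phi> a + k * (x - a))" for x
  have c: "continuous_on {a..b} \<psi>" unfolding \<psi>_def by (intro continuous_intros cont)
  have ends: "\<psi> a = 0" "\<psi> b = 0" using True by (simp_all add: \<psi>_def k_def)
  have "\<psi> (x + t) + \<psi> (x - t) - 2 * \<psi> x = \<phi> (x + t) + \<phi> (x - t) - 2 * \<phi> x" for x t
    by (simp add: \<psi>_def algebra_simps)
  then have l: "((\<lambda>t. (\<psi> (x + t) + \<psi> (x - t) - 2 * \<psi> x) / t\<^sup>2) \<longlongrightarrow> 0) (at 0)" if "x \<in> {a<..<b}" for x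
    using lim[OF that] by simp
  have "((\<lambda>t. (- \<psi> (x + t) + - \<psi> (x - t) - 2 * - \<psi> x) / t\<^sup>2) \<longlongrightarrow> 0) (at 0)" if "x \<in> {a<..<b}" for x
  proof -
    have "(- \<psi> (x + t) + - \<psi> (x - t) - 2 * - \<psi> x) / t\<^sup>2 = - ((\<psi> (x + t) + \<psi> (x - t) - 2 * \<psi> x) / t\<^sup>2)" for t
      unfolding minus_divide_left by (rule arg_cong2[where f = "(/)"]) auto
    then show ?thesis using tendsto_minus[OF l[OF that]] by simp
  qed
  then have "- \<psi> x \<le> 0"
    using Schwarz_second_difference_le[of a b "\<lambda>x. - \<psi> x" x] c ends x by (auto intro: continuous_on_minus)
  moreover have "\<psi> x \<le> 0"
    using Schwarz_second_difference_le[OF c _ _ l x] ends by simp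
  ultimately show ?thesis by (simp add: \<psi>_def k_def)
next
  case False
  then have "x = a" using x by auto
  then show ?thesis by simp
qed

section \<open>The generator\<close>

lemma bounded_linear_fn: "bounded_linear (\<lambda>f. fn f x)"
  by (rule bounded_linear_intro[of _ 1]) (simp_all add: fn_scaleR abs_fn_le_norm)

text \<open>Continuity lets the moments pass to the limit of the cosine quotients.\<close>

lemma bounded_linear_moment: "bounded_linear (moment i)"
proof (rule bounded_linear_intro)
  have c: "continuous_on {0..1} (\<lambda>x. x ^ i * fn f x)" for f
    by (intro continuous_intros continuous_on_fn)
  note int = integrable_continuous_real[OF c]
  show "moment i (f + g) = moment i f + moment i g" for f g
    unfolding moment_def by (simp add: distrib_left integral_add[OF int int])
  show "moment i (r *\<^sub>R f) = r *\<^sub>R moment i f" for r f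
    unfolding moment_def by (simp add: fn_scaleR mult.left_commute)
  fix f
  have "norm (integral {0..1} (\<lambda>x. x ^ i * fn f x)) \<le> norm f * (1 - 0)"
  proof (rule integral_bound)
    fix x :: real assume x: "x \<in> {0..1}"
    then have "\<bar>x ^ i\<bar> * \<bar>fn f x\<bar> \<le> 1 * norm f"
      by (intro mult_mono abs_fn_le_norm) (auto simp: power_le_one)
    then show "norm (x ^ i * fn f x) \<le> norm f" by (simp add: abs_mult)
  qed (use c in auto)
  then show "norm (moment i f) \<le> norm f * 1" by (simp add: moment_def)
qed

lemma fn_cosine_quotient:
  assumes "x \<in> {0..1}"
  shows "fn (cosine_quotient C_mp f t) x =
    (integral_extension f (x + t) + integral_extension f (x - t) - 2 * integral_extension f x) / t\<^sup>2"
proof -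
  \<comment> \<open>At \<open>t = 0\<close> both sides are 0 by the convention for division by
    zero.\<close>
  have "2 / t\<^sup>2 * ((a + b) / 2 - c) = (a + b - 2 * c) / t\<^sup>2" for a b c :: real
    by (cases "t = 0") (simp_all add: field_simps)
  then show ?thesis
    unfolding cosine_quotient_def fn_scaleR fn_diff fn_C_mp[OF assms] integral_extension_eq[OF assms] .
qed

text \<open>The quotient bound depends on \<open>x\<close> only through the oscillation of
  \<open>W\<close> near \<open>x\<close>, which is uniformly small over \<open>[0,1]\<close>; hence
  convergence in the supremum norm.\<close>

lemma cosine_quotient_C_mp_tendsto:
  assumes F: "\<And>x. (integral_extension f has_real_derivative H x) (at x)"
    and H: "\<And>x. (H has_real_derivative W x) (at x)"
    and W: "continuous_on UNIV W" "\<And>x. x \<in> {0..1} \<Longrightarrow> W x = fn y x"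
  shows "(cosine_quotient C_mp f \<longlongrightarrow> y) (at 0)"
proof (rule tendstoI)
  fix e :: real assume e: "0 < e"
  then obtain \<delta> where \<delta>: "0 < \<delta>" "\<And>x s. x \<in> {0..1} \<Longrightarrow> \<bar>s\<bar> < \<delta> \<Longrightarrow> \<bar>W (x + s) - W x\<bar> < e / 3"
    using continuous_uniform_shift[OF W(1), of "e / 3"] by auto
  have "dist (cosine_quotient C_mp f t) y < e" if t: "t \<noteq> 0" "\<bar>t\<bar> < \<delta>" for t
  proof -
    have "norm (cosine_quotient C_mp f t - y) \<le> 2 * (e / 3)"
    proof (rule norm_le_fn)
      fix x :: real assume x: "x \<in> {0..1}"
      have "\<bar>W (x + s) - W x\<bar> \<le> e / 3" if "\<bar>s\<bar> \<le> \<bar>t\<bar>" for s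
        using \<delta>(2)[OF x, of s] that t by simp
      from second_difference_quotient_bound[OF F H this t(1)]
      show "\<bar>fn (cosine_quotient C_mp f t - y) x\<bar> \<le> 2 * (e / 3)"
        unfolding fn_diff fn_cosine_quotient[OF x] W(2)[OF x, symmetric] by simp
    qed
    then show ?thesis using e by (simp add: dist_norm)
  qed
  then show "\<forall>\<^sub>F t in at 0. dist (cosine_quotient C_mp f t) y < e"
    unfolding eventually_at using \<delta>(1) by (intro exI[of _ \<delta>]) auto
qed

section \<open>The boundary conditions give membership in the domain\<close>

lemma antiderivative_unique:
  fixes f g :: "real \<Rightarrow> real"
  assumes "\<And>x. x \<in> {a..b} \<Longrightarrow> (f has_real_derivative h x) (at x within {a..b})"
    and "\<And>x. x \<in> {a..b} \<Longrightarrow> (g has_real_derivative h x) (at x within {a..b})"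
    and "f a = g a" "x \<in> {a..b}"
  shows "f x = g x"
proof -
  have "((\<lambda>x. f x - g x) has_real_derivative 0) (at x within {a..b})" if "x \<in> {a..b}" for x
    using DERIV_diff[OF assms(1,2)[OF that]] by simp
  then obtain c where c: "\<And>x. x \<in> {a..b} \<Longrightarrow> f x - g x = c"
    using has_field_derivative_zero_constant[of "{a..b}" "\<lambda>x. f x - g x"] by auto
  show ?thesis using c[of a] c[of x] assms(3,4) by simp
qed

lemma C01_deriv_unique:
  assumes "C01_deriv f g" "C01_deriv f h"
  shows "g = h"
proof (rule fn_eqI)
  fix x :: real assume x: "x \<in> {0..1}"
  show "fn g x = fn h x"
    by (rule vector_derivative_unique_within_closed_interval[of 0 1 x "fn f"])
       (use assms x in \<open>auto simp: C01_deriv_def has_real_derivative_iff_has_vector_derivative\<close>)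
qed

text \<open>The extension of \<open>f''\<close>, integrated twice with constants matched to
  \<open>f\<close>, is admissible: the residual of each identity has zero second derivative and zero
  value at 0, and a boundary condition makes its slope at 0 vanish.\<close>

lemma integral_extension_C2:
  assumes f': "C01_deriv f f'" and f'': "C01_deriv f' f''"
    and bc: "fn f' 0 = fn f' 1" "fn f' 1 = fn f 1 - fn f 0"
  obtains H where "\<And>x. (integral_extension f has_real_derivative H x) (at x)"
    and "\<And>x. (H has_real_derivative integral_extension f'' x) (at x)"
proof -
  let ?W = "integral_extension f''"
  obtain P where "admissible P ?W" using admissible_integral_extension by blast
  note W = admissibleD[OF this]
  define H where "H x = P x - P 0 + fn f' 0" for x
  have H: "(H has_real_derivative ?W x) (at x)" for x
    unfolding H_def by (auto intro!: derivative_eq_intros W(1))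
  then have "continuous_on UNIV H"
    by (meson DERIV_isCont continuous_at_imp_continuous_on)
  then obtain Q where Q: "\<And>x. (Q has_real_derivative H x) (at x)"
    using antiderivative_UNIV by blast
  define G where "G x = Q x - Q 0 + fn f 0" for x
  have G: "(G has_real_derivative H x) (at x)" for x
    unfolding G_def by (auto intro!: derivative_eq_intros Q)
  then have contG: "continuous_on UNIV G"
    by (meson DERIV_isCont continuous_at_imp_continuous_on)
  then obtain R where R: "\<And>x. (R has_real_derivative G x) (at x)"
    using antiderivative_UNIV by blast
  have Hf: "H x = fn f' x" if x: "x \<in> {0..1}" for x
  proof (rule antiderivative_unique[of 0 1 H "fn f''"])
    show "(H has_real_derivative fn f'' x) (at x within {0..1})" if "x \<in> {0..1}" for x
      using H[of x] that by (auto simp: integral_extension_eq intro: has_field_derivative_at_within)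
  qed (use f'' x in \<open>auto simp: C01_deriv_def H_def\<close>)
  have Gf: "G x = fn f x" if x: "x \<in> {0..1}" for x
  proof (rule antiderivative_unique[of 0 1 G "fn f'"])
    show "(G has_real_derivative fn f' x) (at x within {0..1})" if "x \<in> {0..1}" for x
      using G[of x] that by (auto simp: Hf intro: has_field_derivative_at_within)
  qed (use f' x in \<open>auto simp: C01_deriv_def G_def\<close>)
  have vanish: "r y = 0" if "\<And>y. (r has_real_derivative r' y) (at y)"
    "\<And>y. (r' has_real_derivative 0) (at y)" "r 0 = 0" "r' 0 = 0" for r r' :: "real \<Rightarrow> real" and y
  proof -
    have "r' = (\<lambda>_. 0)" using DERIV_0_eq[of r'] that(2,4) by auto
    then show ?thesis using DERIV_0_eq[of r y] that(1,3) by simp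
  qed
  have "admissible R G"
    unfolding admissible_def
  proof (intro conjI allI)
    fix y
    let ?r = "\<lambda>y. G (1 + y) - G (1 - y) - (G y - G (- y))"
    let ?r' = "\<lambda>y. H (1 + y) - (- H (1 - y)) - (H y - (- H (- y)))"
    have "?r y = 0"
    \<comment> \<open>The slope at 0 is \<open>2 * (H 1 - H 0)\<close>, twice the difference of
      \<open>f'\<close> at the end points.\<close>
    proof (rule vanish[of ?r ?r'])
      show "(?r has_real_derivative ?r' y) (at y)" for y
        by (intro DERIV_diff DERIV_shift_reflect G)
      have "(?r' has_real_derivative ?W (1 + y) - (- (- ?W (1 - y))) - (?W y - (- (- ?W (- y))))) (at y)" for y
        by (intro DERIV_diff DERIV_minus DERIV_shift_reflect H)
      then show "(?r' has_real_derivative 0) (at y)" for y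
        by (rule DERIV_cong) (use W(3)[of y] in simp)
    qed (use bc in \<open>simp_all add: Hf\<close>)
    then show "G (1 + y) - G (1 - y) = G y - G (- y)" by simp
    let ?s = "\<lambda>y. G (1 + y) - G (1 - y) - (R (1 + y) - R y - R (1 - y) + R (- y))"
    let ?s' = "\<lambda>y. H (1 + y) - (- H (1 - y)) - (G (1 + y) - G y - (- G (1 - y)) + (- G (- y)))"
    have "?s y = 0"
    \<comment> \<open>The slope at 0 is \<open>2 * (H 1 - (G 1 - G 0))\<close>. In the second
      derivative \<open>H\<close> may be replaced by \<open>P\<close>, as the constants
      cancel.\<close>
    proof (rule vanish[of ?s ?s'])
      show "(?s has_real_derivative ?s' y) (at y)" for y
        by (intro DERIV_diff DERIV_add DERIV_shift_reflect G R)
      have "(?s' has_real_derivative ?W (1 + y) - (- (- ?W (1 - y)))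
          - (H (1 + y) - H y - (- (- H (1 - y))) + (- (- H (- y))))) (at y)" for y
        by (intro DERIV_diff DERIV_add DERIV_minus DERIV_shift_reflect G H)
      then show "(?s' has_real_derivative 0) (at y)" for y
        by (rule DERIV_cong) (use W(4)[of y] in \<open>simp add: H_def\<close>)
    qed (use bc in \<open>simp_all add: Hf Gf\<close>)
    then show "G (1 + y) - G (1 - y) = R (1 + y) - R y - R (1 - y) + R (- y)" by simp
  qed (use R contG in auto)
  then have "integral_extension f = G"
    using Gf by (rule integral_extension_unique)
  then show thesis using that[of H] G H by simp
qed

lemma cosine_quotient_C_mp_tendsto_C2:
  assumes "C01_deriv f f'" "C01_deriv f' f''" "fn f' 0 = fn f' 1" "fn f' 1 = fn f 1 - fn f 0"
  shows "(cosine_quotient C_mp f \<longlongrightarrow> f'') (at 0)"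
proof -
  obtain H where "\<And>x. (integral_extension f has_real_derivative H x) (at x)"
    "\<And>x. (H has_real_derivative integral_extension f'' x) (at x)"
    using integral_extension_C2[OF assms] by blast
  then show ?thesis
    by (rule cosine_quotient_C_mp_tendsto[OF _ _ continuous_on_integral_extension integral_extension_eq])
qed

section \<open>Membership in the domain gives the boundary conditions\<close>

text \<open>By preservation every cosine quotient already has moment 0.\<close>

lemma moment_eq_0_of_tendsto:
  assumes y: "(cosine_quotient C_mp f \<longlongrightarrow> y) (at 0)"
    and pres: "\<And>t. moment i (C_mp t f) = moment i f"
  shows "moment i y = 0"
proof -
  interpret bounded_linear "moment i" by (rule bounded_linear_moment)
  have "moment i (cosine_quotient C_mp f t) = 0" for t
    by (simp add: cosine_quotient_def scaleR diff pres)
  then have "((\<lambda>_. 0) \<longlongrightarrow> moment i y) (at (0::real))"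
    using tendsto[OF y] by simp
  then show ?thesis
    by (simp add: tendsto_const_iff)
qed

text \<open>With \<open>G\<close> a twofold antiderivative of the extension of \<open>y\<close>, the
  difference \<open>?F - G\<close> has vanishing symmetric second derivative on the open interval,
  so it is affine on \<open>[0,1]\<close> and \<open>f\<close> inherits the smoothness of
  \<open>G\<close>.\<close>

lemma C2_of_cosine_quotient_tendsto:
  assumes y: "(cosine_quotient C_mp f \<longlongrightarrow> y) (at 0)"
  obtains f' where "C01_deriv f f'" "C01_deriv f' y" "fn f' 0 = fn f' 1" "fn f' 1 = fn f 1 - fn f 0"
proof -
  let ?F = "integral_extension f" and ?W = "integral_extension y"
  obtain H where H: "\<And>x. (H has_real_derivative ?W x) (at x)"
    using antiderivative_UNIV[OF continuous_on_integral_extension] by blast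
  then have contH: "continuous_on UNIV H"
    by (meson DERIV_isCont continuous_at_imp_continuous_on)
  then obtain G where G: "\<And>x. (G has_real_derivative H x) (at x)"
    using antiderivative_UNIV by blast
  then have contG: "continuous_on UNIV G"
    by (meson DERIV_isCont continuous_at_imp_continuous_on)
  let ?\<phi> = "\<lambda>x. ?F x - G x"
  define k where "k = ?\<phi> 1 - ?\<phi> 0"
  have lim: "((\<lambda>t. (?\<phi> (x + t) + ?\<phi> (x - t) - 2 * ?\<phi> x) / t\<^sup>2) \<longlongrightarrow> 0) (at 0)"
    if "x \<in> {0<..<1}" for x
  proof -
    have x: "x \<in> {0..1}" using that by auto
    have "((\<lambda>t. fn (cosine_quotient C_mp f t) x) \<longlongrightarrow> fn y x) (at 0)"
      by (rule bounded_linear.tendsto[OF bounded_linear_fn y])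
    from tendsto_diff[OF this second_difference_tendsto[OF G H continuous_on_integral_extension, of x]]
    have "((\<lambda>t. fn (cosine_quotient C_mp f t) x - (G (x + t) + G (x - t) - 2 * G x) / t\<^sup>2) \<longlongrightarrow> 0) (at 0)"
      by (simp add: integral_extension_eq[OF x])
    then show ?thesis
      by (simp add: fn_cosine_quotient[OF x] algebra_simps flip: diff_divide_distrib)
  qed
  have affine: "fn f x = G x + ?\<phi> 0 + k * x" if x: "x \<in> {0..1}" for x
  proof -
    have "?\<phi> x = ?\<phi> 0 + (?\<phi> 1 - ?\<phi> 0) / (1 - 0) * (x - 0)"
      by (rule Schwarz_second_difference[OF _ lim x])
         (auto intro!: continuous_on_diff continuous_on_subset[OF continuous_on_integral_extension]
            continuous_on_subset[OF contG])
    then show ?thesis by (simp add: k_def integral_extension_eq[OF x])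
  qed
  define f' where "f' = of_fn (\<lambda>x. H x + k)"
  have f': "fn f' x = H x + k" if "x \<in> {0..1}" for x
    unfolding f'_def using that
    by (intro fn_of_fn continuous_on_add continuous_on_const continuous_on_subset[OF contH]) auto
  have d1: "C01_deriv f f'"
    unfolding C01_deriv_def
  proof
    fix x :: real assume x: "x \<in> {0..1}"
    have "((\<lambda>x. G x + ?\<phi> 0 + k * x) has_real_derivative H x + k) (at x within {0..1})"
      by (rule has_field_derivative_at_within) (auto intro!: derivative_eq_intros G)
    then show "(fn f has_real_derivative fn f' x) (at x within {0..1})"
      unfolding f'[OF x]
      by (rule has_field_derivative_transform_within[OF _ zero_less_one x]) (rule affine[symmetric])
  qed
  have d2: "C01_deriv f' y"
    unfolding C01_deriv_def
  proof
    fix x :: real assume x: "x \<in> {0..1}"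
    have "((\<lambda>x. H x + k) has_real_derivative fn y x) (at x within {0..1})"
      using has_field_derivative_at_within[OF DERIV_add[OF H[of x] DERIV_const[of k]]]
      by (simp add: integral_extension_eq[OF x])
    then show "(fn f' has_real_derivative fn y x) (at x within {0..1})"
      by (rule has_field_derivative_transform_within[OF _ zero_less_one x]) (rule f'[symmetric])
  qed
  \<comment> \<open>The two moments of \<open>y\<close> are \<open>H 1 - H 0\<close> and
    \<open>H 1 - (G 1 - G 0)\<close>. Since \<open>f'\<close> is \<open>H + k\<close> and
    \<open>f\<close> is \<open>G\<close> plus an affine function of slope \<open>k\<close>, these
    are the defects in the boundary conditions.\<close>
  have "integral {0..1} ?W = moment 0 y"
    unfolding moment_def by (rule integral_cong) (simp add: integral_extension_eq)
  then have H01: "H 1 = H 0"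
    using moment_eq_0_of_tendsto[OF y moment_0_C_mp] integral_eq_antiderivative[OF H] by simp
  have "((\<lambda>x. x * H x - G x) has_real_derivative x * ?W x) (at x)" for x
    using DERIV_diff[OF DERIV_mult[OF DERIV_ident H] G, of x] by (simp add: mult.commute)
  from integral_eq_antiderivative[OF this] have "integral {0..1} (\<lambda>x. x * ?W x) = H 1 - G 1 + G 0"
    by simp
  moreover have "integral {0..1} (\<lambda>x. x * ?W x) = moment 1 y"
    unfolding moment_def by (rule integral_cong) (simp add: integral_extension_eq)
  ultimately have "H 1 = G 1 - G 0"
    using moment_eq_0_of_tendsto[OF y moment_1_C_mp] by simp
  then show thesis
    using that[OF d1 d2] H01 by (simp add: f' affine)
qed

theorem theorem2p5:
  shows "(\<forall>t f. \<forall>x\<in>{0..1}.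
            fn (C_mp t f) x = 1 / 2 * (integral_extension f (x + t) + integral_extension f (x - t)))
       \<and> cosine_family C_mp
       \<and> (\<forall>i\<in>{0, 1}. \<forall>t f. moment i (C_mp t f) = moment i f)
       \<and> generator_dom C_mp =
           {f. \<exists>f' f''. C01_deriv f f' \<and> C01_deriv f' f'' \<and>
                 fn f' 0 = fn f' 1 \<and> fn f' 1 = fn f 1 - fn f 0}
       \<and> (\<forall>f f' f''. f \<in> generator_dom C_mp \<longrightarrow> C01_deriv f f' \<longrightarrow> C01_deriv f' f'' \<longrightarrow>
            generator C_mp f = f'')"
proof (intro conjI)
  show "\<forall>t f. \<forall>x\<in>{0..1}.
      fn (C_mp t f) x = 1 / 2 * (integral_extension f (x + t) + integral_extension f (x - t))"
    by (simp add: fn_C_mp)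
  show "cosine_family C_mp" by (rule cosine_family_C_mp)
  show "\<forall>i\<in>{0, 1}. \<forall>t f. moment i (C_mp t f) = moment i f"
    using moment_0_C_mp moment_1_C_mp by blast
  show dom: "generator_dom C_mp = {f. \<exists>f' f''. C01_deriv f f' \<and> C01_deriv f' f'' \<and>
      fn f' 0 = fn f' 1 \<and> fn f' 1 = fn f 1 - fn f 0}"
    unfolding generator_dom_def
    using C2_of_cosine_quotient_tendsto cosine_quotient_C_mp_tendsto_C2 by (intro Collect_cong) metis
  show "\<forall>f f' f''. f \<in> generator_dom C_mp \<longrightarrow> C01_deriv f f' \<longrightarrow> C01_deriv f' f'' \<longrightarrow>
      generator C_mp f = f''"
  proof (intro allI impI)
    fix f f' f''
    assume f: "f \<in> generator_dom C_mp" "C01_deriv f f'" "C01_deriv f' f''"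
    \<comment> \<open>The domain only provides some pair of derivatives; uniqueness identifies it
      with the given pair and so transfers the boundary conditions.\<close>
    then obtain u v where "C01_deriv f u" "C01_deriv u v" "fn u 0 = fn u 1" "fn u 1 = fn f 1 - fn f 0"
      unfolding dom by blast
    moreover have "u = f'" "v = f''"
      using C01_deriv_unique f(2,3) calculation(1,2) by metis+
    ultimately show "generator C_mp f = f''"
      unfolding generator_def
      using cosine_quotient_C_mp_tendsto_C2[OF f(2,3)] by (intro tendsto_Lim) auto
  qed
qed

end
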